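(* Let $k\ge 0$ be an integer, let $m\ge 1$ be an odd integer, let $t_0=a+ib$ with $a,b\in\mathbb{R}$, $|b|>0$, and let $\alpha=e^{-|b|}$, $0<\alpha<1$. Then the integrals $$\widetilde{B}_0^m(t_0)=\int_0^{2\pi}\frac{dt}{|e^{it}-e^{it_0}|^m},\qquad \widetilde{B}_1^m(t_0)=\int_0^{2\pi}\frac{\sin(t-a)}{|e^{it}-e^{it_0}|^m}\,dt,\qquad \widetilde{S}_k^m(t_0)=\int_0^{2\pi}\frac{\sin^2\!\left(\frac{t-a}{2}\right)e^{ikt}}{|e^{it}-e^{it_0}|^m}\,dt$$ can be computed as $$\widetilde{B}_0^m(t_0)=\frac{2}{(1-\alpha)^{m-1}}\mu_0^m(\alpha),\qquad \widetilde{B}_1^m(t_0)=0,$$ $$\widetilde{S}_k^m(t_0)=C_1\left(-C_2\,\mu_k^m(\alpha)+\frac{2}{m-2}\left(C_3\,\mu_k^{m-2}(\alpha)-C_4\,\mu_{k-1}^{m-2}(\alpha)\right)\right),$$ where $$C_1=\frac{(1-\alpha)^{3-m}}{2}e^{ika},\qquad C_2=\frac{(1-\alpha)^2}{2\alpha(1+\alpha^2)},\qquad C_3=\frac{m/2+k-1}{2\alpha},\qquad C_4=\frac{m/2+k-2}{1+\alpha^2}.$$ Moreover, the quantity $$\mu_k^m(\alpha):=\frac{(1-\alpha)^{m-1}}{2e^{ika}}\,S_k^m(t_0),\qquad S_k^m(t_0)=\int_0^{2\pi}\frac{e^{ikt}}{|e^{it}-e^{it_0}|^m}\,dt,$$ can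 be computed for $m=1,3,5$ through the recurrence formulas $$\mu_k^m(\alpha)=\begin{cases}\dfrac{1+\alpha^2}{\alpha}\,\dfrac{2(k-1)}{2k-1}\,\mu_{k-1}^m(\alpha)-\dfrac{2k-3}{2k-1}\,\mu_{k-2}^m(\alpha), & m=1\text{ and }k=2,3,\dots,\\[2mm] \dfrac{1+\alpha^2}{2\alpha}\,\mu_{k-1}^m(\alpha)-\dfrac{(1-\alpha)^2}{2\alpha}\,\dfrac{m/2+k-2}{m/2-1}\,\mu_{k-1}^{m-2}(\alpha), & m>1\text{ and }k=1,2,\dots,\end{cases}$$ with initial values $$\mu_0^1(\alpha)=2K(\alpha^2),\qquad \mu_1^1(\alpha)=\frac{2}{\alpha}\left(K(\alpha^2)-E(\alpha^2)\right),$$ $$\mu_0^3(\alpha)=\frac{2}{1+\alpha}\left(\frac{2}{1+\alpha}E(\alpha^2)-(1-\alpha)K(\alpha^2)\right),$$ $$\mu_0^5(\alpha)=\frac{2}{3(1+\alpha)^4}\left(8(1+\alpha^2)E(\alpha^2)-(1-\alpha)(1+\alpha)(5+3\alpha^2)K(\alpha^2)\right).$$ Also $\widetilde{S}_{-k}^m(t_0)=\overline{\widetilde{S}_k^m(t_0)}$.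
   Context: The integrals $S_k^m(t_0)$ (the standard Fourier basis integrals) are defined by the displayed formula for every integer $k$; the formula for $\mu_k^m$ is used with the same definition for the indices $k-1$ and $m-2$ that occur. $\widetilde S_{-k}^m$ is defined by the same integral as $\widetilde S_k^m$ with $k$ replaced by $-k$. The complete elliptic integrals of the first and second kind are $$K(\alpha^2)=\int_0^{\pi/2}\frac{d\theta}{\sqrt{1-\alpha^2\sin^2\theta}},\qquad E(\alpha^2)=\int_0^{\pi/2}\sqrt{1-\alpha^2\sin^2\theta}\,d\theta .$$
   Formalization: For b<0 the printed formulas fail (e.g. μ_0^1 = 2αK(α²), not 2K(α²)); there the μ^{m-2} terms in the S̃ formula and the m>1 recurrence get a factor α², and the initial values of μ^m a factor α^m. For b>0 everything is as printed. *)

theory Defs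
  imports "HOL-Analysis.Analysis"
begin

text \<open>Exponents \<open>m\<close> and frequencies \<open>k\<close> are integers: the formulas below also use
  \<open>m - 2\<close> (which is \<open>- 1\<close> for \<open>m = 1\<close>), \<open>k - 1\<close> and \<open>- k\<close>.
  The kernels have no singularity on \<open>[0, 2\<pi>]\<close> when \<open>Im t0 \<noteq> 0\<close>, so the integrands
  are continuous there.\<close>

definition dist_circle :: "complex \<Rightarrow> real \<Rightarrow> real" where
  "dist_circle t0 t = cmod (exp (\<i> * complex_of_real t) - exp (\<i> * t0))"

definition S_int :: "int \<Rightarrow> int \<Rightarrow> complex \<Rightarrow> complex" where
  "S_int k m t0 = integral {0..2 * pi} (\<lambda>t.
     exp (\<i> * of_int k * complex_of_real t) / complex_of_real (dist_circle t0 t powi m))"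

definition B0_int :: "int \<Rightarrow> complex \<Rightarrow> real" where
  "B0_int m t0 = integral {0..2 * pi} (\<lambda>t. 1 / dist_circle t0 t powi m)"

definition B1_int :: "int \<Rightarrow> complex \<Rightarrow> real" where
  "B1_int m t0 = integral {0..2 * pi} (\<lambda>t. sin (t - Re t0) / dist_circle t0 t powi m)"

definition St_int :: "int \<Rightarrow> int \<Rightarrow> complex \<Rightarrow> complex" where
  "St_int k m t0 = integral {0..2 * pi} (\<lambda>t.
     complex_of_real ((sin ((t - Re t0) / 2))\<^sup>2) * exp (\<i> * of_int k * complex_of_real t)
       / complex_of_real (dist_circle t0 t powi m))"

text \<open>The normalised integral is written as a function of \<open>t0\<close>, since it is defined through
  \<open>S_int k m t0\<close>; that it depends on the imaginary part of \<open>t0\<close> only is a statement to prove.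
  Since \<open>\<bar>exp (\<i> * t0)\<bar> = exp (- Im t0)\<close>, with \<open>\<alpha> = exp (- \<bar>Im t0\<bar>)\<close> all the integrals above at \<open>t0\<close> with
  \<open>Im t0 < 0\<close> are \<open>\<alpha> ^ m\<close> times those at \<open>cnj t0\<close>; closed forms in \<open>\<alpha>\<close> therefore differ
  between the two signs of \<open>Im t0\<close>.\<close>

definition mu :: "int \<Rightarrow> int \<Rightarrow> complex \<Rightarrow> complex" where
  "mu k m t0 = complex_of_real ((1 - exp (- \<bar>Im t0\<bar>)) powi (m - 1))
     / (2 * exp (\<i> * of_int k * complex_of_real (Re t0))) * S_int k m t0"

text \<open>The complete elliptic integrals take the parameter (the squared modulus) as argument.\<close>

definition ellK :: "real \<Rightarrow> real" where
  "ellK x = integral {0..pi / 2} (\<lambda>\<theta>. 1 / sqrt (1 - x * (sin \<theta>)\<^sup>2))"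

definition ellE :: "real \<Rightarrow> real" where
  "ellE x = integral {0..pi / 2} (\<lambda>\<theta>. sqrt (1 - x * (sin \<theta>)\<^sup>2))"

end

theory Submission
  imports Defs
begin

text \<open>
  With \<open>\<alpha> = exp (- \<bar>b\<bar>)\<close>, the distance \<open>|e^(it) - e^(i t0)|\<close> is
  \<open>sqrt (1 + \<alpha>^2 - 2 \<alpha> cos (t - a))\<close>, divided by \<open>\<alpha>\<close> when \<open>b < 0\<close>. Periodicity and symmetry
  reduce everything to \<open>J(k,m) = \<integral> cos (k s) (1 + \<alpha>^2 - 2 \<alpha> cos s)^(-m/2) ds\<close> over a period.
  Integrating the derivative of \<open>sin (j s) (1 + \<alpha>^2 - 2 \<alpha> cos s)^(1 - m/2)\<close> gives
  \<open>j J(j,m-2) = (m/2 - 1) \<alpha> (J(j-1,m) - J(j+1,m))\<close>, and the definition of the radicand gives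
  \<open>J(j,m-2) = (1 + \<alpha>^2) J(j,m) - \<alpha> (J(j-1,m) + J(j+1,m))\<close>. All recurrences, and the
  formula for \<open>St_int\<close>, are linear consequences of these two relations; the initial values reduce to
  \<open>J(0,1)\<close> and \<open>J(1,1)\<close>, which a Landen substitution turns into elliptic integrals.
\<close>

section \<open>Integrals of periodic functions over a full period\<close>

lemma periodic_int_shift:
  fixes f :: "real \<Rightarrow> 'a"
  assumes per: "\<And>x. f (x + p) = f x"
  shows "f (x + of_int n * p) = f x"
proof -
  have nat: "f (x + of_nat n * p) = f x" for n x
  proof (induction n)
    case (Suc n)
    have "f (x + of_nat (Suc n) * p) = f ((x + of_nat n * p) + p)"
      by (simp add: algebra_simps)
    then show ?case using per Suc by simp
  qed simp
  show ?thesis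
  proof (cases n)
    case (nonneg k)
    then show ?thesis using nat[of x k] by simp
  next
    case (neg k)
    then have "of_int n = - real (Suc k)" by simp
    then have "x + of_int n * p + of_nat (Suc k) * p = x" by algebra
    then show ?thesis using nat[of "x + of_int n * p" "Suc k"] by metis
  qed
qed

text \<open>The shift \<open>- c\<close> is reduced modulo \<open>p\<close> to some \<open>r\<close>
  between \<open>0\<close> and \<open>p\<close>. The window from \<open>r\<close> to
  \<open>p + r\<close> is then cut at \<open>p\<close>, and the part beyond \<open>p\<close> is
  moved back by one period.\<close>

lemma integral_periodic_translate:
  fixes f :: "real \<Rightarrow> 'a::banach"
  assumes cont: "continuous_on UNIV f" and per: "\<And>x. f (x + p) = f x" and "p > 0"
  shows "integral {0..p} (\<lambda>x. f (x - c)) = integral {0..p} f"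
proof -
  have int: "f integrable_on {u..v}" for u v
    by (meson cont continuous_on_subset integrable_continuous_interval subset_UNIV)
  have shift: "integral {u..v} (\<lambda>x. f (x + d)) = integral {u + d..v + d} f" for u v d
    using integral_shift_real_ivl[of "u + d" d "v + d" f] by simp
  define n where "n = \<lfloor>- c / p\<rfloor>"
  define r where "r = - c - of_int n * p"
  have r: "0 \<le> r" "r \<le> p"
  proof -
    have "of_int n \<le> - c / p" "- c / p < of_int n + 1" unfolding n_def by linarith+
    then show "0 \<le> r" "r \<le> p" using \<open>p > 0\<close> by (simp_all add: r_def field_simps)
  qed
  have "f (x - c) = f (x + r)" for x
    using periodic_int_shift[of f p "x + r" n, OF per] by (simp add: r_def)
  then have "integral {0..p} (\<lambda>x. f (x - c)) = integral {r..p + r} f"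
    using shift[of 0 p r] by simp
  also have "\<dots> = integral {r..p} f + integral {p..p + r} f"
    using Henstock_Kurzweil_Integration.integral_combine[of r p "p + r" f] r int by simp
  also have "integral {p..p + r} f = integral {0..r} f"
    using shift[of 0 r p] per by (simp add: add.commute)
  also have "integral {r..p} f + integral {0..r} f = integral {0..p} f"
    using Henstock_Kurzweil_Integration.integral_combine[of 0 r p f] r int by (simp add: add.commute)
  finally show ?thesis .
qed

lemma integral_reflect_Icc:
  fixes f :: "real \<Rightarrow> 'a::euclidean_space"
  shows "integral {0..p} (\<lambda>x. f (p - x)) = integral {0..p} f"
proof -
  have "integral {0..p} (\<lambda>x. f (p - x)) = integral {- p..0} (\<lambda>x. f (x + p))"
    using Henstock_Kurzweil_Integration.integral_reflect_real[of 0 "- p" "\<lambda>x. f (x + p)"]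
    by simp
  also have "\<dots> = integral {0..p} f"
    using integral_shift_real_ivl[of 0 p p f] by simp
  finally show ?thesis .
qed

text \<open>Translation by \<open>a\<close> splits off the phase. For the rest, \<open>s\<close> to
  \<open>2 * pi - s\<close> conjugates the integrand because \<open>w\<close> is even and real, so
  the integral equals its own conjugate and only the cosine part survives. This phase is the one
  that \<open>mu\<close> divides out.\<close>

lemma integral_even_Fourier:
  fixes w :: "real \<Rightarrow> real"
  assumes cont: "continuous_on UNIV w" and per: "\<And>x. w (x + 2 * pi) = w x"
    and even: "\<And>x. w (- x) = w x"
  shows "integral {0..2 * pi} (\<lambda>t. exp (\<i> * of_int k * complex_of_real t) * of_real (w (t - a))) =
    exp (\<i> * of_int k * of_real a) * of_real (integral {0..2 * pi} (\<lambda>s. cos (of_int k * s) * w s))"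
proof -
  define e where "e s = exp (\<i> * of_int k * complex_of_real s)" for s
  have [continuous_intros]: "continuous_on UNIV e"
    unfolding e_def by (intro continuous_intros)
  define F where "F s = e s * of_real (w s)" for s
  have contF: "continuous_on UNIV F"
    unfolding F_def using cont by (intro continuous_intros)
  have eper: "e (x + 2 * pi) = e x" for x
    using exp_integer_2pi[of "of_int k"]
    unfolding e_def by (simp add: algebra_simps exp_add)
  have Fper: "F (x + 2 * pi) = F x" for x
    by (simp add: F_def eper per)
  have intF: "F integrable_on {0..2 * pi}"
    by (meson contF continuous_on_subset integrable_continuous_interval subset_UNIV)
  have Fcnj: "F (2 * pi - x) = cnj (F x)" for x
  proof -
    have "F (2 * pi - x) = F (- x)" using Fper[of "- x"] by (simp add: add.commute)
    also have "\<dots> = cnj (F x)" by (simp add: F_def e_def even exp_cnj)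
    finally show ?thesis .
  qed
  have re: "Re (F s) = cos (of_int k * s) * w s" for s
    by (simp add: F_def e_def Re_exp)
  have "cnj (integral {0..2 * pi} F) = integral {0..2 * pi} F"
    using integral_reflect_Icc[of "2 * pi" F] Fcnj by (simp add: integral_cnj)
  then have "integral {0..2 * pi} F = of_real (Re (integral {0..2 * pi} F))"
    by (metis Reals_cnj_iff of_real_Re)
  also have "Re (integral {0..2 * pi} F) = integral {0..2 * pi} (\<lambda>s. cos (of_int k * s) * w s)"
    using integral_linear[OF intF bounded_linear_Re] re by (simp add: o_def)
  finally have *: "integral {0..2 * pi} F =
    of_real (integral {0..2 * pi} (\<lambda>s. cos (of_int k * s) * w s))" .
  have "e t * of_real (w (t - a)) = e a * F (t - a)" for t
    by (simp add: F_def e_def algebra_simps flip: exp_add)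
  then have "integral {0..2 * pi} (\<lambda>t. e t * of_real (w (t - a))) =
      e a * integral {0..2 * pi} (\<lambda>t. F (t - a))"
    by simp
  also have "\<dots> = e a * integral {0..2 * pi} F"
    using integral_periodic_translate[OF contF Fper] by simp
  finally show ?thesis using * by (simp add: e_def)
qed

lemma integral_odd_periodic:
  fixes w :: "real \<Rightarrow> real"
  assumes cont: "continuous_on UNIV w" and per: "\<And>x. w (x + 2 * pi) = w x"
    and odd: "\<And>x. w (- x) = - w x"
  shows "integral {0..2 * pi} (\<lambda>t. w (t - a)) = 0"
proof -
  have "w (2 * pi - x) = - w x" for x
    using per[of "- x"] odd[of x] by (simp add: add.commute)
  then have "integral {0..2 * pi} w = - integral {0..2 * pi} w"
    using integral_reflect_Icc[of "2 * pi" w] by simp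
  then show ?thesis using integral_periodic_translate[OF cont per] by simp
qed

text \<open>Periodicity and evenness together give the symmetry \<open>h (pi - x) = h x\<close>,
  which folds a half period onto a quarter. It serves to match integrals over the circle with the
  range of \<open>ellK\<close> and \<open>ellE\<close>.\<close>

lemma integral_quarter_period:
  fixes h :: "real \<Rightarrow> real"
  assumes cont: "continuous_on UNIV h" and per: "\<And>x. h (x + pi) = h x"
    and even: "\<And>x. h (- x) = h x"
  shows "integral {0..2 * pi} h = 4 * integral {0..pi / 2} h"
proof -
  have int: "h integrable_on {u..v}" for u v
    by (meson cont continuous_on_subset integrable_continuous_interval subset_UNIV)
  have refl: "h (pi - x) = h x" for x
    using per[of "- x"] even[of x] by (simp add: add.commute)
  have "integral {pi..2 * pi} h = integral {0..pi} h"
    using integral_shift_real_ivl[of pi pi "2 * pi" h] per by simp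
  moreover have "integral {pi / 2..pi} h = integral {0..pi / 2} h"
  proof -
    have "integral {pi / 2..pi} h = integral {- pi..- (pi / 2)} h"
      using Henstock_Kurzweil_Integration.integral_reflect_real[of pi "pi / 2" h] even by simp
    also have "\<dots> = integral {0..pi / 2} (\<lambda>x. h (x + - pi))"
      using integral_shift_real_ivl[of "- pi" "- pi" "- (pi / 2)" h] by simp
    also have "\<dots> = integral {0..pi / 2} h"
      using per[of "x - pi" for x] by (simp add: field_simps)
    finally show ?thesis .
  qed
  ultimately show ?thesis
    using Henstock_Kurzweil_Integration.integral_combine[of 0 pi "2 * pi" h] Henstock_Kurzweil_Integration.integral_combine[of 0 "pi / 2" pi h] int by simp
qed

section \<open>The model integrals \<open>Jint\<close> and their linear relations\<close>

text \<open>By the law of cosines, this is the distance from the point of the unit circle at angle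
  \<open>s\<close> to the real point \<open>\<alpha>\<close>.\<close>

definition chord :: "real \<Rightarrow> real \<Rightarrow> real" where
  "chord \<alpha> s = sqrt (1 + \<alpha>\<^sup>2 - 2 * \<alpha> * cos s)"

definition Jint :: "real \<Rightarrow> int \<Rightarrow> int \<Rightarrow> real" where
  "Jint \<alpha> k m = integral {0..2 * pi} (\<lambda>s. cos (of_int k * s) / chord \<alpha> s powi m)"

lemma chord_radicand_pos:
  fixes \<alpha> s :: real
  assumes "0 < \<alpha>" "\<alpha> < 1"
  shows "1 + \<alpha>\<^sup>2 - 2 * \<alpha> * cos s > 0"
proof -
  have "1 - \<alpha> \<noteq> 0" using assms by linarith
  then have "0 < (1 - \<alpha>)\<^sup>2" by simp
  also have "(1 - \<alpha>)\<^sup>2 \<le> 1 + \<alpha>\<^sup>2 - 2 * \<alpha> * cos s"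
    using assms mult_left_mono[of "cos s" 1 \<alpha>] by (simp add: power2_eq_square algebra_simps)
  finally show ?thesis .
qed

lemma chord_pos:
  assumes "0 < \<alpha>" "\<alpha> < 1"
  shows "chord \<alpha> s > 0"
  using chord_radicand_pos[OF assms] by (simp add: chord_def)

lemma chord_sq:
  assumes "0 < \<alpha>" "\<alpha> < 1"
  shows "(chord \<alpha> s)\<^sup>2 = 1 + \<alpha>\<^sup>2 - 2 * \<alpha> * cos s"
  using chord_radicand_pos[OF assms, of s] by (simp add: chord_def)

lemma continuous_on_chord [continuous_intros]: "continuous_on A (chord \<alpha>)"
  unfolding chord_def by (intro continuous_intros)

lemma continuous_on_divide_chord_powi:
  assumes "0 < \<alpha>" "\<alpha> < 1" and "continuous_on A f"
  shows "continuous_on A (\<lambda>s. f s / chord \<alpha> s powi m)"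
proof -
  have "chord \<alpha> s \<noteq> 0" for s using chord_pos[OF assms(1,2), of s] by simp
  then show ?thesis using assms(3) by (intro continuous_intros) auto
qed

lemma has_real_derivative_chord:
  assumes "0 < \<alpha>" "\<alpha> < 1"
  shows "(chord \<alpha> has_real_derivative \<alpha> * sin s / chord \<alpha> s) (at s)"
proof -
  have "((\<lambda>s. 1 + \<alpha>\<^sup>2 - 2 * \<alpha> * cos s) has_real_derivative 2 * \<alpha> * sin s) (at s)"
    by (auto intro!: derivative_eq_intros)
  from DERIV_chain2[OF DERIV_real_sqrt[OF chord_radicand_pos[OF assms]] this]
  show ?thesis
    unfolding chord_def by (rule DERIV_cong) (simp add: field_simps)
qed

lemma has_integral_Jint:
  assumes "0 < \<alpha>" "\<alpha> < 1"
  shows "((\<lambda>s. cos (of_int k * s) / chord \<alpha> s powi m) has_integral Jint \<alpha> k m) {0..2 * pi}"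
  unfolding Jint_def
  by (intro integrable_integral integrable_continuous_interval continuous_on_divide_chord_powi
      assms continuous_intros)

lemma Jint_minus: "Jint \<alpha> (- k) m = Jint \<alpha> k m"
  by (simp add: Jint_def)

text \<open>The primitive \<open>H\<close> vanishes at both ends of the period because of its sine
  factor. Its derivative contains \<open>sin (j s) * sin s\<close>, which the product-to-sum formula
  turns into the neighbouring frequencies \<open>j - 1\<close> and \<open>j + 1\<close>.\<close>

lemma Jint_deriv_relation:
  assumes \<alpha>: "0 < \<alpha>" "\<alpha> < 1"
  shows "of_int j * Jint \<alpha> j (m - 2) =
    (of_int m - 2) / 2 * \<alpha> * (Jint \<alpha> (j - 1) m - Jint \<alpha> (j + 1) m)"
proof -
  define H where "H s = sin (of_int j * s) * chord \<alpha> s powi (2 - m)" for s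
  define h where "h s = of_int j * (cos (of_int j * s) / chord \<alpha> s powi (m - 2)) -
    (of_int m - 2) / 2 * \<alpha> *
      (cos (of_int (j - 1) * s) / chord \<alpha> s powi m - cos (of_int (j + 1) * s) / chord \<alpha> s powi m)"
    for s
  have ne: "chord \<alpha> s \<noteq> 0" for s using chord_pos[OF \<alpha>, of s] by simp
  have "(H has_real_derivative h s) (at s)" for s
  proof -
    have "(H has_real_derivative of_int j * cos (of_int j * s) * chord \<alpha> s powi (2 - m) +
      sin (of_int j * s) * (of_int (2 - m) * chord \<alpha> s powi (2 - m - 1) *
        (\<alpha> * sin s / chord \<alpha> s))) (at s)"
      unfolding H_def
      by (rule DERIV_cong[OF DERIV_mult[OF _ DERIV_power_int[OF has_real_derivative_chord[OF \<alpha>]]]])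
        (auto intro!: derivative_eq_intros simp: ne)
    also have "of_int j * cos (of_int j * s) * chord \<alpha> s powi (2 - m) +
      sin (of_int j * s) * (of_int (2 - m) * chord \<alpha> s powi (2 - m - 1) *
        (\<alpha> * sin s / chord \<alpha> s)) = h s"
    proof -
      have 1: "chord \<alpha> s powi (2 - m) = 1 / chord \<alpha> s powi (m - 2)"
        using power_int_minus_divide[of "chord \<alpha> s" "m - 2"] by simp
      have "chord \<alpha> s powi (1 - m) / chord \<alpha> s = chord \<alpha> s powi (- m)"
        using ne[of s] by (simp add: power_int_diff power_int_minus field_simps)
      then have 2: "chord \<alpha> s powi (2 - m - 1) / chord \<alpha> s = 1 / chord \<alpha> s powi m"
        by (simp add: power_int_minus_divide)
      have 3: "cos (of_int (j - 1) * s) - cos (of_int (j + 1) * s) = 2 * (sin (of_int j * s) * sin s)"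
        by (simp add: algebra_simps cos_add cos_diff)
      have "sin (of_int j * s) * (of_int (2 - m) * chord \<alpha> s powi (2 - m - 1) *
          (\<alpha> * sin s / chord \<alpha> s)) =
        of_int (2 - m) * \<alpha> * (sin (of_int j * s) * sin s) *
          (chord \<alpha> s powi (2 - m - 1) / chord \<alpha> s)"
        by simp
      also have "\<dots> = - ((of_int m - 2) / 2 * \<alpha> * ((cos (of_int (j - 1) * s) - cos (of_int (j + 1) * s))
          / chord \<alpha> s powi m))"
        unfolding 2 3 using ne[of s] by (simp add: field_simps)
      finally show ?thesis unfolding h_def 1 by (simp add: diff_divide_distrib)
    qed
    finally show ?thesis .
  qed
  then have "(h has_integral (H (2 * pi) - H 0)) {0..2 * pi}"
    by (intro fundamental_theorem_of_calculus)
      (auto simp: has_real_derivative_iff_has_vector_derivative[symmetric]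
        intro: has_field_derivative_at_within)
  moreover have "sin (of_int j * (2 * pi)) = 0"
    using sin_int_2pin[of j] by (simp add: mult.commute)
  then have "H (2 * pi) - H 0 = 0" by (simp add: H_def)
  ultimately have "(h has_integral 0) {0..2 * pi}" by simp
  moreover have "(h has_integral (of_int j * Jint \<alpha> j (m - 2) -
      (of_int m - 2) / 2 * \<alpha> * (Jint \<alpha> (j - 1) m - Jint \<alpha> (j + 1) m))) {0..2 * pi}"
    unfolding h_def
    by (intro has_integral_diff has_integral_mult_right has_integral_Jint \<alpha>)
  ultimately have "0 = of_int j * Jint \<alpha> j (m - 2) -
      (of_int m - 2) / 2 * \<alpha> * (Jint \<alpha> (j - 1) m - Jint \<alpha> (j + 1) m)"
    by (rule has_integral_unique)
  then show ?thesis by simp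
qed

text \<open>Lowering the exponent by 2 puts one factor \<open>(chord \<alpha> s)^2\<close> into the
  numerator. Its term in \<open>cos s\<close> shifts the frequency by one in both
  directions.\<close>

lemma Jint_radicand_relation:
  assumes \<alpha>: "0 < \<alpha>" "\<alpha> < 1"
  shows "Jint \<alpha> j (m - 2) =
    (1 + \<alpha>\<^sup>2) * Jint \<alpha> j m - \<alpha> * (Jint \<alpha> (j - 1) m + Jint \<alpha> (j + 1) m)"
proof -
  define h where "h s = (1 + \<alpha>\<^sup>2) * (cos (of_int j * s) / chord \<alpha> s powi m) -
    \<alpha> * (cos (of_int (j - 1) * s) / chord \<alpha> s powi m + cos (of_int (j + 1) * s) / chord \<alpha> s powi m)"
    for s
  have "cos (of_int j * s) / chord \<alpha> s powi (m - 2) = h s" for s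
  proof -
    have ne: "chord \<alpha> s \<noteq> 0" using chord_pos[OF \<alpha>, of s] by simp
    have 1: "cos (of_int (j - 1) * s) + cos (of_int (j + 1) * s) = 2 * (cos (of_int j * s) * cos s)"
      by (simp add: algebra_simps cos_add cos_diff)
    have "cos (of_int j * s) / chord \<alpha> s powi (m - 2) =
      cos (of_int j * s) * (chord \<alpha> s)\<^sup>2 / chord \<alpha> s powi m"
      using ne by (simp add: power_int_diff)
    also have "\<dots> = ((1 + \<alpha>\<^sup>2) * cos (of_int j * s) -
        \<alpha> * (cos (of_int (j - 1) * s) + cos (of_int (j + 1) * s))) / chord \<alpha> s powi m"
      unfolding 1 chord_sq[OF \<alpha>] by (simp add: algebra_simps)
    finally show ?thesis by (simp add: h_def diff_divide_distrib add_divide_distrib distrib_left)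
  qed
  moreover have "(h has_integral ((1 + \<alpha>\<^sup>2) * Jint \<alpha> j m -
      \<alpha> * (Jint \<alpha> (j - 1) m + Jint \<alpha> (j + 1) m))) {0..2 * pi}"
    unfolding h_def
    by (intro has_integral_diff has_integral_add has_integral_mult_right has_integral_Jint \<alpha>)
  ultimately show ?thesis by (simp add: Jint_def integral_unique)
qed

text \<open>Elimination of \<open>Jint \<alpha> (j + 1) m\<close> from the two basic relations; the
  companion below eliminates \<open>Jint \<alpha> (j - 1) m\<close> instead. The factor
  \<open>m - 2\<close> is kept on both sides, so no division occurs.\<close>

lemma Jint_frequency_down:
  assumes \<alpha>: "0 < \<alpha>" "\<alpha> < 1"
  shows "2 * \<alpha> * (of_int m - 2) * Jint \<alpha> (j - 1) m =
    (of_int m - 2) * (1 + \<alpha>\<^sup>2) * Jint \<alpha> j m - (of_int m - 2 - 2 * of_int j) * Jint \<alpha> j (m - 2)"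
  using Jint_deriv_relation[OF \<alpha>, of j m] Jint_radicand_relation[OF \<alpha>, of j m] by algebra

lemma Jint_frequency_up:
  assumes \<alpha>: "0 < \<alpha>" "\<alpha> < 1"
  shows "2 * \<alpha> * (of_int m - 2) * Jint \<alpha> (j + 1) m =
    (of_int m - 2) * (1 + \<alpha>\<^sup>2) * Jint \<alpha> j m - (of_int m - 2 + 2 * of_int j) * Jint \<alpha> j (m - 2)"
  using Jint_deriv_relation[OF \<alpha>, of j m] Jint_radicand_relation[OF \<alpha>, of j m] by algebra

text \<open>The upward relation at \<open>k - 1\<close> and the downward one at \<open>k\<close>
  form a linear system for \<open>Jint \<alpha> k m\<close> and
  \<open>Jint \<alpha> (k - 1) m\<close>. Eliminating the latter leaves the determinant
  \<open>(1 + \<alpha>^2)^2 - 4 * \<alpha>^2 = (1 - \<alpha>^2)^2\<close>.\<close>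

lemma Jint_exponent_lower:
  assumes \<alpha>: "0 < \<alpha>" "\<alpha> < 1"
  shows "(1 - \<alpha>\<^sup>2)\<^sup>2 * (of_int m - 2) * Jint \<alpha> k m =
    (1 + \<alpha>\<^sup>2) * (of_int m - 2 - 2 * of_int k) * Jint \<alpha> k (m - 2) +
    2 * \<alpha> * (of_int m + 2 * of_int k - 4) * Jint \<alpha> (k - 1) (m - 2)"
proof -
  have "2 * \<alpha> * (of_int m - 2) * Jint \<alpha> k m =
    (of_int m - 2) * (1 + \<alpha>\<^sup>2) * Jint \<alpha> (k - 1) m -
      (of_int m - 2 + 2 * (of_int k - 1)) * Jint \<alpha> (k - 1) (m - 2)"
    using Jint_frequency_up[OF \<alpha>, of m "k - 1"] by simp
  with Jint_frequency_down[OF \<alpha>, of m k] show ?thesis by algebra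
qed

text \<open>At \<open>m = 1\<close> both basic relations contain the single integral
  \<open>Jint \<alpha> (k - 1) (- 1)\<close>; eliminating it leaves only exponent 1.\<close>

lemma Jint_1_recurrence:
  assumes \<alpha>: "0 < \<alpha>" "\<alpha> < 1"
  shows "(2 * of_int k - 1) * \<alpha> * Jint \<alpha> k 1 =
    2 * (of_int k - 1) * (1 + \<alpha>\<^sup>2) * Jint \<alpha> (k - 1) 1 - (2 * of_int k - 3) * \<alpha> * Jint \<alpha> (k - 2) 1"
  using Jint_deriv_relation[OF \<alpha>, of "k - 1" 1] Jint_radicand_relation[OF \<alpha>, of "k - 1" 1]
  by (simp add: algebra_simps) algebra

section \<open>Reduction of exponent 1 to complete elliptic integrals\<close>

text \<open>The two sides differ by the constant \<open>1 - \<alpha>^2\<close>. Bounding by the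
  cosine term, and not merely by 0, makes \<open>\<Delta> x - \<alpha> * cos x\<close> positive, so
  that it is the root picked by \<open>chord\<close>.\<close>

lemma elliptic_radicand_gt:
  assumes "0 < \<alpha>" "\<alpha> < (1::real)"
  shows "1 - \<alpha>\<^sup>2 * (sin x)\<^sup>2 > (\<alpha> * cos x)\<^sup>2"
proof -
  have "\<alpha>\<^sup>2 < 1" using assms by (simp add: power_less_one_iff abs_square_less_1)
  moreover have "1 - \<alpha>\<^sup>2 * (sin x)\<^sup>2 - (\<alpha> * cos x)\<^sup>2 = 1 - \<alpha>\<^sup>2"
    by (simp add: power_mult_distrib cos_squared_eq algebra_simps)
  ultimately show ?thesis by linarith
qed

text \<open>In the triangle with sides \<open>1\<close> and \<open>\<alpha>\<close> enclosing the angle \<open>s\<close>, the third side is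
  \<open>chord \<alpha> s\<close>. The law of sines suggests the substitution \<open>s = x - arcsin (\<alpha> sin x)\<close>, where
  \<open>\<pi> - x\<close> is the angle opposite the side \<open>1\<close>; projecting the two sides onto the third one gives
  \<open>chord \<alpha> s = \<Delta> x - \<alpha> cos x\<close>.\<close>

lemma has_integral_elliptic_substitution:
  assumes \<alpha>: "0 < \<alpha>" "\<alpha> < 1"
  defines "\<Delta> \<equiv> \<lambda>x. sqrt (1 - \<alpha>\<^sup>2 * (sin x)\<^sup>2)"
  shows "((\<lambda>x. 1 / \<Delta> x) has_integral Jint \<alpha> 0 1) {0..2 * pi}"
    and "((\<lambda>x. cos x + (1 / \<Delta> x - \<Delta> x) / \<alpha>) has_integral Jint \<alpha> 1 1) {0..2 * pi}"
proof -
  define g where "g x = x - arcsin (\<alpha> * sin x)" for x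
  have rad: "1 - \<alpha>\<^sup>2 * (sin x)\<^sup>2 > (\<alpha> * cos x)\<^sup>2" for x
    using elliptic_radicand_gt[OF \<alpha>] .
  have \<Delta>sq: "(\<Delta> x)\<^sup>2 = 1 - \<alpha>\<^sup>2 * (sin x)\<^sup>2" for x
    unfolding \<Delta>_def using rad[of x] zero_le_power2[of "\<alpha> * cos x"]
    by (intro real_sqrt_pow2) linarith
  have \<Delta>gt: "\<Delta> x > \<bar>\<alpha> * cos x\<bar>" for x
    unfolding \<Delta>_def using rad[of x] by (simp add: real_less_rsqrt)
  have \<Delta>pos: "\<Delta> x > 0" for x
    using \<Delta>gt[of x] by linarith
  have bnd: "\<bar>\<alpha> * sin x\<bar> < 1" for x
  proof -
    have "\<bar>\<alpha> * sin x\<bar> \<le> \<alpha> * 1" unfolding abs_mult using \<alpha> by (intro mult_mono) auto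
    then show ?thesis using \<alpha> by simp
  qed
  then have bnd': "- 1 < \<alpha> * sin x" "\<alpha> * sin x < 1" for x
    using abs_less_iff[of "\<alpha> * sin x" 1] by auto
  have cos\<phi>: "cos (arcsin (\<alpha> * sin x)) = \<Delta> x" for x
    using cos_arcsin[of "\<alpha> * sin x"] bnd'[of x] by (simp add: \<Delta>_def power_mult_distrib)
  have sin\<phi>: "sin (arcsin (\<alpha> * sin x)) = \<alpha> * sin x" for x
    using bnd'[of x] by simp
  have cosg: "cos (g x) = cos x * \<Delta> x + \<alpha> * (sin x)\<^sup>2" for x
    by (simp add: g_def cos_diff cos\<phi> sin\<phi> power2_eq_square)
  have chordg: "chord \<alpha> (g x) = \<Delta> x - \<alpha> * cos x" for x
  proof -
    have "1 + \<alpha>\<^sup>2 - 2 * \<alpha> * cos (g x) = (\<Delta> x - \<alpha> * cos x)\<^sup>2"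
      unfolding cosg power2_diff \<Delta>sq power_mult_distrib cos_squared_eq
      by (simp add: algebra_simps power2_eq_square)
    then show ?thesis using \<Delta>gt[of x] by (simp add: chord_def)
  qed
  have gdiff: "(g has_real_derivative 1 - \<alpha> * cos x / \<Delta> x) (at x within A)" for x A
    unfolding g_def
    by (rule derivative_eq_intros refl bnd')+
      (simp add: \<Delta>_def power_mult_distrib divide_simps)
  have subst: "((\<lambda>x. (1 - \<alpha> * cos x / \<Delta> x) * (cos (of_int k * g x) / chord \<alpha> (g x) powi 1))
      has_integral Jint \<alpha> k 1) {0..2 * pi}" for k
  proof -
    \<comment> \<open>The substitution rule asks for an interval that contains the image of
      \<open>g\<close> and on which the integrand is continuous. As the arcsine is at most
      \<open>pi / 2\<close> in absolute value, this generous interval suffices.\<close>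
    have "g ` {0..2 * pi} \<subseteq> {- pi..3 * pi}"
    proof safe
      fix x assume "x \<in> {0..2 * pi}"
      moreover have "- (pi / 2) \<le> arcsin (\<alpha> * sin x)" "arcsin (\<alpha> * sin x) \<le> pi / 2"
        using arcsin_bounded[of "\<alpha> * sin x"] bnd'[of x] by auto
      ultimately show "g x \<in> {- pi..3 * pi}" using pi_gt_zero by (auto simp: g_def)
    qed
    moreover have "continuous_on {- pi..3 * pi} (\<lambda>s. cos (of_int k * s) / chord \<alpha> s powi 1)"
      by (intro continuous_on_divide_chord_powi \<alpha> continuous_intros)
    moreover have "g 0 = 0" "g (2 * pi) = 2 * pi" by (simp_all add: g_def)
    ultimately show ?thesis
      using has_integral_substitution[of 0 "2 * pi" g "- pi" "3 * pi"
          "\<lambda>s. cos (of_int k * s) / chord \<alpha> s powi 1", OF _ _ _ _ gdiff]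
      by (simp add: Jint_def)
  qed
  \<comment> \<open>The derivative of \<open>g\<close> is
    \<open>(\<Delta> x - \<alpha> * cos x) / \<Delta> x\<close>, whose numerator is exactly
    \<open>chord \<alpha> (g x)\<close>. This cancellation leaves the elliptic integrand
    \<open>1 / \<Delta> x\<close>.\<close>
  have jac: "(1 - \<alpha> * cos x / \<Delta> x) / (\<Delta> x - \<alpha> * cos x) = 1 / \<Delta> x" for x
    using \<Delta>pos[of x] \<Delta>gt[of x] by (simp add: divide_simps)
  show "((\<lambda>x. 1 / \<Delta> x) has_integral Jint \<alpha> 0 1) {0..2 * pi}"
    using subst[of 0] by (simp add: chordg jac)
  have "(1 - \<alpha> * cos x / \<Delta> x) * (cos (g x) / (\<Delta> x - \<alpha> * cos x)) =
      cos x + (1 / \<Delta> x - \<Delta> x) / \<alpha>" for x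
  proof -
    have "(1 - \<alpha> * cos x / \<Delta> x) * (cos (g x) / (\<Delta> x - \<alpha> * cos x)) = 1 / \<Delta> x * cos (g x)"
      using jac[of x] by (metis times_divide_eq_left times_divide_eq_right)
    \<comment> \<open>Here \<open>\<alpha> * (sin x)^2\<close> from \<open>cosg\<close> is rewritten
      as \<open>(1 - (\<Delta> x)^2) / \<alpha>\<close>, which splits into the integrands of
      \<open>ellK\<close> and \<open>ellE\<close>.\<close>
    also have "\<dots> = cos x + (1 - (\<Delta> x)\<^sup>2) / (\<alpha> * \<Delta> x)"
      unfolding \<Delta>sq cosg using \<Delta>pos[of x] \<alpha> by (simp add: field_simps power2_eq_square)
    also have "\<dots> = cos x + (1 / \<Delta> x - \<Delta> x) / \<alpha>"
      using \<Delta>pos[of x] \<alpha> by (simp add: field_simps power2_eq_square)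
    finally show ?thesis .
  qed
  then show "((\<lambda>x. cos x + (1 / \<Delta> x - \<Delta> x) / \<alpha>) has_integral Jint \<alpha> 1 1) {0..2 * pi}"
    using subst[of 1] by (simp add: chordg)
qed

text \<open>The cosine term integrates to zero over the period. The remaining integrands are even
  with period \<open>pi\<close>, so each contributes four times its integral up to
  \<open>pi / 2\<close>.\<close>

lemma Jint_elliptic:
  assumes \<alpha>: "0 < \<alpha>" "\<alpha> < 1"
  shows "Jint \<alpha> 0 1 = 4 * ellK (\<alpha>\<^sup>2)"
    and "Jint \<alpha> 1 1 = 4 / \<alpha> * (ellK (\<alpha>\<^sup>2) - ellE (\<alpha>\<^sup>2))"
proof -
  let ?\<Delta> = "\<lambda>x. sqrt (1 - \<alpha>\<^sup>2 * (sin x)\<^sup>2)"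
  have ne: "?\<Delta> x \<noteq> 0" for x
  proof -
    have "0 < 1 - \<alpha>\<^sup>2 * (sin x)\<^sup>2"
      using elliptic_radicand_gt[OF \<alpha>, of x] zero_le_power2[of "\<alpha> * cos x"] by linarith
    then show ?thesis by simp
  qed
  have K: "integral {0..2 * pi} (\<lambda>x. 1 / ?\<Delta> x) = 4 * ellK (\<alpha>\<^sup>2)"
    unfolding ellK_def using ne
    by (intro integral_quarter_period continuous_intros) auto
  have E: "integral {0..2 * pi} ?\<Delta> = 4 * ellE (\<alpha>\<^sup>2)"
    unfolding ellE_def by (intro integral_quarter_period continuous_intros) auto
  show J0: "Jint \<alpha> 0 1 = 4 * ellK (\<alpha>\<^sup>2)"
    using has_integral_elliptic_substitution(1)[OF \<alpha>] K by (simp add: integral_unique)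
  have "(?\<Delta> has_integral 4 * ellE (\<alpha>\<^sup>2)) {0..2 * pi}"
    unfolding E[symmetric]
    by (intro integrable_integral integrable_continuous_interval continuous_intros)
  moreover have "(cos has_integral (sin (2 * pi) - sin 0)) {0..2 * pi}"
    by (intro fundamental_theorem_of_calculus)
      (auto simp: has_real_derivative_iff_has_vector_derivative[symmetric]
        intro!: derivative_eq_intros)
  ultimately have "((\<lambda>x. cos x + (1 / ?\<Delta> x - ?\<Delta> x) / \<alpha>) has_integral
      (sin (2 * pi) - sin 0) + (4 * ellK (\<alpha>\<^sup>2) - 4 * ellE (\<alpha>\<^sup>2)) / \<alpha>) {0..2 * pi}"
    using has_integral_elliptic_substitution(1)[OF \<alpha>] unfolding J0
    by (intro has_integral_add has_integral_divide has_integral_diff)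
  then have "Jint \<alpha> 1 1 = (sin (2 * pi) - sin 0) + (4 * ellK (\<alpha>\<^sup>2) - 4 * ellE (\<alpha>\<^sup>2)) / \<alpha>"
    using has_integral_elliptic_substitution(2)[OF \<alpha>] has_integral_unique by blast
  then show "Jint \<alpha> 1 1 = 4 / \<alpha> * (ellK (\<alpha>\<^sup>2) - ellE (\<alpha>\<^sup>2))"
    by (simp add: algebra_simps diff_divide_distrib)
qed

section \<open>Passage from the integrals at \<open>t0\<close> to \<open>Jint\<close>\<close>

text \<open>The point \<open>exp (\<i> * t0)\<close> has modulus \<open>exp (- b)\<close>. For
  \<open>b < 0\<close> this is \<open>1 / \<alpha>\<close>, and extracting
  \<open>1 / \<alpha>^2\<close> from the radicand gives back the radicand for
  \<open>\<alpha>\<close>.\<close>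

lemma dist_circle_conv_chord:
  fixes a b :: real
  assumes "b \<noteq> 0"
  defines "\<alpha> \<equiv> exp (- \<bar>b\<bar>)"
  shows "dist_circle (Complex a b) t = chord \<alpha> (t - a) / (if b > 0 then 1 else \<alpha>)"
proof -
  have e: "exp (\<i> * Complex a b) = of_real (exp (- b)) * cis a"
    by (simp add: exp_eq_polar Re_exp Im_exp complex_eq_iff)
  have sq: "(cos t - r * cos a)\<^sup>2 + (sin t - r * sin a)\<^sup>2 = 1 + r\<^sup>2 - 2 * r * cos (t - a)"
    for r :: real
  proof -
    have "(cos t - r * cos a)\<^sup>2 + (sin t - r * sin a)\<^sup>2 =
      ((sin t)\<^sup>2 + (cos t)\<^sup>2) + r\<^sup>2 * ((sin a)\<^sup>2 + (cos a)\<^sup>2) - 2 * r * cos (t - a)"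
      unfolding cos_diff by algebra
    then show ?thesis by simp
  qed
  have d: "dist_circle (Complex a b) t = chord (exp (- b)) (t - a)"
    by (simp add: dist_circle_def e cmod_def Re_exp Im_exp chord_def sq)
  show ?thesis
  proof (cases "b > 0")
    case False
    then have b: "exp (- b) = 1 / \<alpha>" using assms by (simp add: exp_minus field_simps)
    have "\<alpha> > 0" by (simp add: \<alpha>_def)
    then have "1 + (1 / \<alpha>)\<^sup>2 - 2 * (1 / \<alpha>) * cos (t - a) =
        (1 + \<alpha>\<^sup>2 - 2 * \<alpha> * cos (t - a)) / \<alpha>\<^sup>2"
      by (simp add: field_simps power2_eq_square)
    then show ?thesis using False \<open>\<alpha> > 0\<close> by (simp add: d b chord_def real_sqrt_divide)
  qed (simp add: d \<alpha>_def)
qed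

text \<open>The weight \<open>f\<close> covers both families: it is constant for
  \<open>S_int\<close> and a squared half-angle sine for \<open>St_int\<close>. The factor
  \<open>\<sigma>\<close> records the side of the unit circle on which the point lies.\<close>

lemma integral_div_dist_circle:
  fixes a b :: real and f :: "real \<Rightarrow> real"
  assumes "b \<noteq> 0" and cont: "continuous_on UNIV f" and per: "\<And>x. f (x + 2 * pi) = f x"
    and even: "\<And>x. f (- x) = f x"
  defines "\<alpha> \<equiv> exp (- \<bar>b\<bar>)" and "\<sigma> \<equiv> if b > 0 then 1 else exp (- \<bar>b\<bar>)"
  shows "integral {0..2 * pi} (\<lambda>t. of_real (f (t - a)) * exp (\<i> * of_int k * complex_of_real t)
      / complex_of_real (dist_circle (Complex a b) t powi m)) =
    exp (\<i> * of_int k * of_real a) *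
      of_real (\<sigma> powi m * integral {0..2 * pi} (\<lambda>s. f s * (cos (of_int k * s) / chord \<alpha> s powi m)))"
proof -
  have \<alpha>: "0 < \<alpha>" "\<alpha> < 1" using assms(1) by (simp_all add: \<alpha>_def)
  define w where "w s = \<sigma> powi m * (f s / chord \<alpha> s powi m)" for s
  have d: "dist_circle (Complex a b) t = chord \<alpha> (t - a) / \<sigma>" for t
    using dist_circle_conv_chord[OF assms(1)] by (simp add: \<alpha>_def \<sigma>_def)
  have "of_real (f (t - a)) * exp (\<i> * of_int k * complex_of_real t)
      / complex_of_real (dist_circle (Complex a b) t powi m) =
    exp (\<i> * of_int k * complex_of_real t) * of_real (w (t - a))" for t
    by (simp add: d w_def power_int_divide_distrib)
  moreover have "continuous_on UNIV w"
    unfolding w_def by (intro continuous_intros continuous_on_divide_chord_powi \<alpha> cont)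
  moreover have "w (x + 2 * pi) = w x" "w (- x) = w x" for x
    by (simp_all add: w_def per even chord_def)
  moreover have "integral {0..2 * pi} (\<lambda>s. cos (of_int k * s) * w s) =
      \<sigma> powi m * integral {0..2 * pi} (\<lambda>s. f s * (cos (of_int k * s) / chord \<alpha> s powi m))"
    unfolding integral_mult_right[symmetric] by (simp add: w_def mult_ac)
  ultimately show ?thesis
    using integral_even_Fourier[of w k a] by simp
qed

lemma S_int_conv_Jint:
  fixes a b :: real
  assumes "b \<noteq> 0"
  defines "\<alpha> \<equiv> exp (- \<bar>b\<bar>)" and "\<sigma> \<equiv> if b > 0 then 1 else exp (- \<bar>b\<bar>)"
  shows "S_int k m (Complex a b) = exp (\<i> * of_int k * of_real a) * of_real (\<sigma> powi m * Jint \<alpha> k m)"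
  using integral_div_dist_circle[OF assms(1), of "\<lambda>_. 1" a k m]
  by (simp add: S_int_def Jint_def \<alpha>_def \<sigma>_def)

lemma mu_conv_Jint:
  fixes a b :: real
  assumes "b \<noteq> 0"
  defines "\<alpha> \<equiv> exp (- \<bar>b\<bar>)" and "\<sigma> \<equiv> if b > 0 then 1 else exp (- \<bar>b\<bar>)"
  shows "mu k m (Complex a b) = of_real ((1 - \<alpha>) powi (m - 1) / 2 * \<sigma> powi m * Jint \<alpha> k m)"
  using S_int_conv_Jint[OF assms(1), of k m a] by (simp add: mu_def \<alpha>_def \<sigma>_def)

text \<open>The weight is affine in the squared distance: \<open>(sin (s / 2))^2 = ((chord \<alpha>
  s)^2 - (1 - \<alpha>)^2) / (4 * \<alpha>)\<close>. Its first term lowers the exponent by 2 and its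
  second keeps it.\<close>

lemma St_int_conv_Jint:
  fixes a b :: real
  assumes "b \<noteq> 0"
  defines "\<alpha> \<equiv> exp (- \<bar>b\<bar>)" and "\<sigma> \<equiv> if b > 0 then 1 else exp (- \<bar>b\<bar>)"
  shows "St_int k m (Complex a b) = exp (\<i> * of_int k * of_real a) *
    of_real (\<sigma> powi m * ((Jint \<alpha> k (m - 2) - (1 - \<alpha>)\<^sup>2 * Jint \<alpha> k m) / (4 * \<alpha>)))"
proof -
  have \<alpha>: "0 < \<alpha>" "\<alpha> < 1" using assms(1) by (simp_all add: \<alpha>_def)
  \<comment> \<open>The half-angle sine changes sign over \<open>2 * pi\<close>; only its square has
    this period.\<close>
  have per: "(sin ((x + 2 * pi) / 2))\<^sup>2 = (sin (x / 2))\<^sup>2" for x :: real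
    by (simp add: add_divide_distrib)
  have "(sin (s / 2))\<^sup>2 * (cos (of_int k * s) / chord \<alpha> s powi m) =
      (cos (of_int k * s) / chord \<alpha> s powi (m - 2) -
        (1 - \<alpha>)\<^sup>2 * (cos (of_int k * s) / chord \<alpha> s powi m)) / (4 * \<alpha>)" for s
  proof -
    have "(sin (s / 2))\<^sup>2 = (1 - cos s) / 2"
      using cos_double_sin[of "s / 2"] by simp
    moreover have "(1 - cos s) / 2 = ((chord \<alpha> s)\<^sup>2 - (1 - \<alpha>)\<^sup>2) / (4 * \<alpha>)"
      unfolding chord_sq[OF \<alpha>] using \<alpha> by (simp add: power2_eq_square field_simps)
    ultimately have "(sin (s / 2))\<^sup>2 = ((chord \<alpha> s)\<^sup>2 - (1 - \<alpha>)\<^sup>2) / (4 * \<alpha>)"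
      by simp
    moreover have "cos (of_int k * s) * ((chord \<alpha> s)\<^sup>2 / chord \<alpha> s powi m) =
        cos (of_int k * s) / chord \<alpha> s powi (m - 2)"
      using chord_pos[OF \<alpha>, of s] by (simp add: power_int_diff)
    moreover have "(D - q) / d * (c / P) = (c * (D / P) - q * (c / P)) / d" for D q d c P :: real
      by (simp add: algebra_simps flip: diff_divide_distrib)
    ultimately show ?thesis by (simp only:)
  qed
  moreover have "((\<lambda>s. (cos (of_int k * s) / chord \<alpha> s powi (m - 2) -
        (1 - \<alpha>)\<^sup>2 * (cos (of_int k * s) / chord \<alpha> s powi m)) / (4 * \<alpha>)) has_integral
      (Jint \<alpha> k (m - 2) - (1 - \<alpha>)\<^sup>2 * Jint \<alpha> k m) / (4 * \<alpha>)) {0..2 * pi}"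
    by (intro has_integral_divide has_integral_diff has_integral_mult_right has_integral_Jint \<alpha>)
  ultimately have "integral {0..2 * pi} (\<lambda>s. (sin (s / 2))\<^sup>2 * (cos (of_int k * s) / chord \<alpha> s powi m)) =
      (Jint \<alpha> k (m - 2) - (1 - \<alpha>)\<^sup>2 * Jint \<alpha> k m) / (4 * \<alpha>)"
    by (simp only: integral_unique)
  moreover have "continuous_on UNIV (\<lambda>s::real. (sin (s / 2))\<^sup>2)"
    by (intro continuous_intros) auto
  ultimately show ?thesis
    using integral_div_dist_circle[OF assms(1), of "\<lambda>s. (sin (s / 2))\<^sup>2" a k m] per
    by (simp add: St_int_def \<alpha>_def \<sigma>_def)
qed

lemma B0_int_eq_S_int:
  fixes a b :: real
  assumes "b \<noteq> 0"
  shows "of_real (B0_int m (Complex a b)) = S_int 0 m (Complex a b)"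
proof -
  have "continuous_on UNIV (dist_circle (Complex a b))"
    unfolding dist_circle_def by (intro continuous_intros)
  moreover have "dist_circle (Complex a b) t \<noteq> 0" for t
    using dist_circle_conv_chord[OF assms, of a t] chord_pos[of "exp (- \<bar>b\<bar>)" "t - a"] assms
    by (auto split: if_splits)
  ultimately have "(\<lambda>t. 1 / dist_circle (Complex a b) t powi m) integrable_on {0..2 * pi}"
    by (intro integrable_continuous_interval continuous_intros)
      (auto intro: continuous_on_subset)
  from integral_linear[OF this bounded_linear_of_real]
  have "integral {0..2 * pi} (complex_of_real \<circ> (\<lambda>t. 1 / dist_circle (Complex a b) t powi m)) =
    of_real (integral {0..2 * pi} (\<lambda>t. 1 / dist_circle (Complex a b) t powi m))" .
  then show ?thesis
    by (simp add: B0_int_def S_int_def o_def)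
qed

text \<open>After translation by \<open>a\<close>, the integrand is an odd sine over an even
  kernel.\<close>

lemma B1_int_eq_0:
  fixes a b :: real
  assumes "b \<noteq> 0"
  shows "B1_int m (Complex a b) = 0"
proof -
  define \<alpha> where "\<alpha> = exp (- \<bar>b\<bar>)"
  define \<sigma> where "\<sigma> = (if b > 0 then 1 else \<alpha>)"
  have \<alpha>: "0 < \<alpha>" "\<alpha> < 1" using assms by (simp_all add: \<alpha>_def)
  define w where "w s = \<sigma> powi m * (sin s / chord \<alpha> s powi m)" for s
  have "dist_circle (Complex a b) t = chord \<alpha> (t - a) / \<sigma>" for t
    using dist_circle_conv_chord[OF assms] by (simp add: \<alpha>_def \<sigma>_def)
  then have "B1_int m (Complex a b) = integral {0..2 * pi} (\<lambda>t. w (t - a))"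
    by (simp add: B1_int_def w_def power_int_divide_distrib mult.commute)
  also have "\<dots> = 0"
  proof (rule integral_odd_periodic)
    show "continuous_on UNIV w"
      unfolding w_def by (intro continuous_intros continuous_on_divide_chord_powi \<alpha>)
  qed (simp_all add: w_def chord_def)
  finally show ?thesis .
qed

lemma St_int_minus: "St_int (- k) m t0 = cnj (St_int k m t0)"
  by (simp add: St_int_def integral_cnj exp_cnj)

text \<open>Here \<open>n\<close> stands for \<open>m - 2\<close>, while \<open>X\<close>,
  \<open>Y\<close>, \<open>Z\<close> stand for \<open>Jint\<close> at \<open>(k, m - 2)\<close>,
  \<open>(k, m)\<close>, \<open>(k - 1, m - 2)\<close>, and \<open>rel\<close> is
  \<open>Jint_exponent_lower\<close>. Since
  \<open>2 * (1 + \<alpha>^2) - (1 - \<alpha>)^2 = (1 + \<alpha>)^2\<close>, the coefficients of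
  \<open>Y\<close> on the two sides differ by
  \<open>(1 - \<alpha>^2)^2 / (8 * \<alpha> * (1 + \<alpha>^2))\<close>, which is the multiple of
  \<open>Y\<close> that \<open>rel\<close> converts into \<open>X\<close> and
  \<open>Z\<close>.\<close>

lemma St_coefficient_identity:
  fixes \<alpha> n k X Y Z :: real
  assumes "\<alpha> > 0" "n \<noteq> 0"
    and rel: "(1 - \<alpha>\<^sup>2)\<^sup>2 * n * Y = (1 + \<alpha>\<^sup>2) * (n - 2 * k) * X + 2 * \<alpha> * (n + 2 * k - 2) * Z"
  shows "(X - (1 - \<alpha>)\<^sup>2 * Y) / (4 * \<alpha>) =
    (- ((1 - \<alpha>)\<^sup>2 / (2 * \<alpha> * (1 + \<alpha>\<^sup>2)) * (1 - \<alpha>)\<^sup>2 * Y) +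
      2 / n * ((n / 2 + k) / (2 * \<alpha>) * X - (n / 2 + k - 1) / (1 + \<alpha>\<^sup>2) * Z)) / 4"
proof -
  \<comment> \<open>Naming \<open>1 + \<alpha>^2\<close> keeps it an atom while denominators are
    cleared; \<open>algebra\<close> expands it only at the end.\<close>
  define p where "p = 1 + \<alpha>\<^sup>2"
  have "p \<noteq> 0" using zero_le_power2[of \<alpha>] unfolding p_def by linarith
  then show ?thesis
    using rel assms(1,2) unfolding p_def[symmetric]
    by (simp add: divide_simps) (use p_def in algebra)
qed

section \<open>Formulas for \<open>mu\<close> and \<open>St_int\<close>, uniform in the sign of
  \<open>b\<close> through \<open>\<sigma>\<close>\<close>

context
  fixes a b \<alpha> \<sigma> :: real
  assumes b: "b \<noteq> 0"
  defines "\<alpha> \<equiv> exp (- \<bar>b\<bar>)" and "\<sigma> \<equiv> if b > 0 then 1 else exp (- \<bar>b\<bar>)"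
begin

lemma modulus_bounds: "0 < \<alpha>" "\<alpha> < 1"
  using b by (simp_all add: \<alpha>_def)

lemma scale_nonzero: "\<sigma> \<noteq> 0"
  by (simp add: \<sigma>_def)

lemmas mu_Jint = mu_conv_Jint[OF b, where a = a, folded \<alpha>_def \<sigma>_def]

text \<open>The terms with \<open>mu\<close> at \<open>m\<close> carry
  \<open>\<sigma> powi m\<close>, those at \<open>m - 2\<close> carry
  \<open>\<sigma> powi (m - 2)\<close>; the explicit \<open>\<sigma>^2\<close> compensates. The
  powers of \<open>1 - \<alpha>\<close> are all expressed through \<open>P\<close>, which cancels
  against the prefactor, and \<open>St_coefficient_identity\<close> remains.\<close>

lemma St_int_formula:
  assumes "m \<noteq> 2"
  shows "St_int k m (Complex a b) =
    of_real ((1 - \<alpha>) powi (3 - m) / 2) * exp (\<i> * of_int k * of_real a) *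
    (- of_real ((1 - \<alpha>)\<^sup>2 / (2 * \<alpha> * (1 + \<alpha>\<^sup>2))) * mu k m (Complex a b) +
      of_real (2 / (of_int m - 2) * \<sigma>\<^sup>2) *
        (of_real ((of_int m / 2 + of_int k - 1) / (2 * \<alpha>)) * mu k (m - 2) (Complex a b) -
         of_real ((of_int m / 2 + of_int k - 2) / (1 + \<alpha>\<^sup>2)) * mu (k - 1) (m - 2) (Complex a b)))"
proof -
  define P where "P = (1 - \<alpha>) powi (m - 3)"
  define S where "S = \<sigma> powi (m - 2)"
  define X where "X = Jint \<alpha> k (m - 2)"
  define Y where "Y = Jint \<alpha> k m"
  define Z where "Z = Jint \<alpha> (k - 1) (m - 2)"
  note \<alpha> = modulus_bounds
  have P: "P \<noteq> 0" using \<alpha> by (simp add: P_def)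
  have p1: "(1 - \<alpha>) powi (m - 1) = P * (1 - \<alpha>)\<^sup>2" and p2: "(1 - \<alpha>) powi (3 - m) = 1 / P"
    and p3: "(1 - \<alpha>) powi (m - 2 - 1) = P"
    using power_int_add[of "1 - \<alpha>" "m - 3" 2] power_int_minus_divide[of "1 - \<alpha>" "m - 3"] \<alpha>
    by (simp_all add: P_def)
  have s1: "\<sigma> powi m = S * \<sigma>\<^sup>2"
    using power_int_add[of \<sigma> "m - 2" 2] scale_nonzero by (simp add: S_def)
  have "real_of_int m - 2 \<noteq> 0" using assms by linarith
  moreover have "(1 - \<alpha>\<^sup>2)\<^sup>2 * (of_int m - 2) * Y =
      (1 + \<alpha>\<^sup>2) * ((of_int m - 2) - 2 * of_int k) * X + 2 * \<alpha> * ((of_int m - 2) + 2 * of_int k - 2) * Z"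
    unfolding X_def Y_def Z_def Jint_exponent_lower[OF \<alpha>, of m k] by simp
  ultimately have "(X - (1 - \<alpha>)\<^sup>2 * Y) / (4 * \<alpha>) =
    (- ((1 - \<alpha>)\<^sup>2 / (2 * \<alpha> * (1 + \<alpha>\<^sup>2)) * (1 - \<alpha>)\<^sup>2 * Y) +
      2 / (of_int m - 2) * (((of_int m - 2) / 2 + of_int k) / (2 * \<alpha>) * X -
        ((of_int m - 2) / 2 + of_int k - 1) / (1 + \<alpha>\<^sup>2) * Z)) / 4"
    using \<alpha> by (intro St_coefficient_identity) auto
  moreover have "(of_int m - 2) / 2 + of_int k = of_int m / 2 + of_int k - (1 :: real)"
    "(of_int m - 2) / 2 + of_int k - 1 = of_int m / 2 + of_int k - (2 :: real)"
    by (simp_all add: field_simps)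
  ultimately have id: "(X - (1 - \<alpha>)\<^sup>2 * Y) / (4 * \<alpha>) =
    (- ((1 - \<alpha>)\<^sup>2 / (2 * \<alpha> * (1 + \<alpha>\<^sup>2)) * (1 - \<alpha>)\<^sup>2 * Y) +
      2 / (of_int m - 2) * ((of_int m / 2 + of_int k - 1) / (2 * \<alpha>) * X -
        (of_int m / 2 + of_int k - 2) / (1 + \<alpha>\<^sup>2) * Z)) / 4"
    by simp
  have "S * \<sigma>\<^sup>2 * ((X - (1 - \<alpha>)\<^sup>2 * Y) / (4 * \<alpha>)) = 1 / P / 2 *
    (- ((1 - \<alpha>)\<^sup>2 / (2 * \<alpha> * (1 + \<alpha>\<^sup>2))) * (P * (1 - \<alpha>)\<^sup>2 / 2 * (S * \<sigma>\<^sup>2) * Y) +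
      2 / (of_int m - 2) * \<sigma>\<^sup>2 * ((of_int m / 2 + of_int k - 1) / (2 * \<alpha>) * (P / 2 * S * X) -
        (of_int m / 2 + of_int k - 2) / (1 + \<alpha>\<^sup>2) * (P / 2 * S * Z)))"
    (is "_ = ?rhs")
  proof -
    have "?rhs = S * \<sigma>\<^sup>2 * ((- ((1 - \<alpha>)\<^sup>2 / (2 * \<alpha> * (1 + \<alpha>\<^sup>2)) * (1 - \<alpha>)\<^sup>2 * Y) +
      2 / (of_int m - 2) * ((of_int m / 2 + of_int k - 1) / (2 * \<alpha>) * X -
        (of_int m / 2 + of_int k - 2) / (1 + \<alpha>\<^sup>2) * Z)) / 4)"
      (is "1 / P / 2 * (- ?c2 * _ + ?c * _ * (?c3 * _ - ?c4 * _)) = _")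
    proof -
      \<comment> \<open>The coefficients are abstracted to variables so that \<open>P\<close> is the
        only symbolic denominator to be cleared.\<close>
      have "1 / P / 2 * (- c2 * (P * q / 2 * (S * r) * Y) + c * r * (c3 * (P / 2 * S * X) - c4 * (P / 2 * S * Z))) =
        S * r * ((- (c2 * q * Y) + c * (c3 * X - c4 * Z)) / 4)" for c2 q r c c3 c4
        using P by (simp add: field_simps)
      then show ?thesis .
    qed
    then show ?thesis unfolding id by simp
  qed
  then show ?thesis
    unfolding St_int_conv_Jint[OF b, folded \<alpha>_def \<sigma>_def] mu_Jint p1 p2 p3 s1
      X_def[symmetric] Y_def[symmetric] Z_def[symmetric] S_def[symmetric]
    by (simp only: of_real_mult of_real_add of_real_diff of_real_minus mult_ac)
qed

lemma mu_recurrence_1: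
  assumes "2 \<le> k"
  shows "mu k 1 (Complex a b) =
    of_real ((1 + \<alpha>\<^sup>2) / \<alpha> * (2 * (of_int k - 1) / (2 * of_int k - 1))) * mu (k - 1) 1 (Complex a b) -
    of_real ((2 * of_int k - 3) / (2 * of_int k - 1)) * mu (k - 2) 1 (Complex a b)"
proof -
  have "2 * real_of_int k - 1 \<noteq> 0" using assms by linarith
  then have "Jint \<alpha> k 1 = (1 + \<alpha>\<^sup>2) / \<alpha> * (2 * (of_int k - 1) / (2 * of_int k - 1)) * Jint \<alpha> (k - 1) 1 -
      (2 * of_int k - 3) / (2 * of_int k - 1) * Jint \<alpha> (k - 2) 1"
    using Jint_1_recurrence[OF modulus_bounds, of k] modulus_bounds(1)
    by (simp add: divide_simps) (simp add: algebra_simps)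
  \<comment> \<open>At \<open>m = 1\<close> the power of \<open>1 - \<alpha>\<close> is 1, so
    \<open>mu\<close> is \<open>\<sigma> / 2\<close> times \<open>Jint\<close> at every
    frequency.\<close>
  then have "\<sigma> / 2 * Jint \<alpha> k 1 =
      (1 + \<alpha>\<^sup>2) / \<alpha> * (2 * (of_int k - 1) / (2 * of_int k - 1)) * (\<sigma> / 2 * Jint \<alpha> (k - 1) 1) -
      (2 * of_int k - 3) / (2 * of_int k - 1) * (\<sigma> / 2 * Jint \<alpha> (k - 2) 1)"
    by algebra
  then show ?thesis
    unfolding mu_Jint of_real_mult[symmetric] of_real_diff[symmetric] by simp
qed

text \<open>This is \<open>Jint_frequency_up\<close> at \<open>k - 1\<close>, divided by
  \<open>2 * \<alpha> * (m - 2)\<close>. The factors \<open>(1 - \<alpha>)^2\<close> and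
  \<open>\<sigma>^2\<close> come from the different normalisations at exponents \<open>m\<close> and
  \<open>m - 2\<close>.\<close>

lemma mu_recurrence_exponent:
  assumes "m \<noteq> 2"
  shows "mu k m (Complex a b) = of_real ((1 + \<alpha>\<^sup>2) / (2 * \<alpha>)) * mu (k - 1) m (Complex a b) -
    of_real (\<sigma>\<^sup>2 * (1 - \<alpha>)\<^sup>2 / (2 * \<alpha>) * ((of_int m / 2 + of_int k - 2) / (of_int m / 2 - 1))) *
      mu (k - 1) (m - 2) (Complex a b)"
proof -
  define P where "P = (1 - \<alpha>) powi (m - 3)"
  define S where "S = \<sigma> powi (m - 2)"
  have p: "(1 - \<alpha>) powi (m - 1) = P * (1 - \<alpha>)\<^sup>2" "(1 - \<alpha>) powi (m - 2 - 1) = P"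
    using power_int_add[of "1 - \<alpha>" "m - 3" 2] modulus_bounds by (simp_all add: P_def)
  have s: "\<sigma> powi m = S * \<sigma>\<^sup>2"
    using power_int_add[of \<sigma> "m - 2" 2] scale_nonzero by (simp add: S_def)
  have ne: "real_of_int m - 2 \<noteq> 0" using assms by linarith
  have q: "(of_int m / 2 + of_int k - 2) / (of_int m / 2 - 1) =
      (of_int m + 2 * of_int k - 4) / (of_int m - (2 :: real))"
    using ne by (simp add: divide_simps) (simp add: algebra_simps)
  have "Jint \<alpha> k m = (1 + \<alpha>\<^sup>2) / (2 * \<alpha>) * Jint \<alpha> (k - 1) m -
      1 / (2 * \<alpha>) * ((of_int m / 2 + of_int k - 2) / (of_int m / 2 - 1)) * Jint \<alpha> (k - 1) (m - 2)"
    using Jint_frequency_up[OF modulus_bounds, of m "k - 1"] modulus_bounds(1) ne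
    unfolding q by (simp add: divide_simps) (simp add: algebra_simps)
  then have "P * (1 - \<alpha>)\<^sup>2 / 2 * (S * \<sigma>\<^sup>2) * Jint \<alpha> k m =
      P * (1 - \<alpha>)\<^sup>2 / 2 * (S * \<sigma>\<^sup>2) * ((1 + \<alpha>\<^sup>2) / (2 * \<alpha>) * Jint \<alpha> (k - 1) m -
        1 / (2 * \<alpha>) * ((of_int m / 2 + of_int k - 2) / (of_int m / 2 - 1)) * Jint \<alpha> (k - 1) (m - 2))"
    by (simp only:)
  also have "\<dots> = (1 + \<alpha>\<^sup>2) / (2 * \<alpha>) * (P * (1 - \<alpha>)\<^sup>2 / 2 * (S * \<sigma>\<^sup>2) * Jint \<alpha> (k - 1) m) -
      \<sigma>\<^sup>2 * (1 - \<alpha>)\<^sup>2 / (2 * \<alpha>) * ((of_int m / 2 + of_int k - 2) / (of_int m / 2 - 1)) *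
        (P / 2 * S * Jint \<alpha> (k - 1) (m - 2))"
    by (simp only: right_diff_distrib divide_inverse mult_ac mult_1_left)
  finally show ?thesis
    unfolding mu_Jint p s S_def[symmetric] of_real_mult[symmetric] of_real_diff[symmetric]
    by (rule arg_cong)
qed

text \<open>Exponents 3 and 5 are lowered to 1 by \<open>Jint_exponent_lower\<close> at frequency 0,
  where the frequency \<open>- 1\<close> it produces equals frequency 1 by
  \<open>Jint_minus\<close>.\<close>

lemma mu_initial_values:
  defines "K \<equiv> ellK (\<alpha>\<^sup>2)" and "E \<equiv> ellE (\<alpha>\<^sup>2)"
  shows "mu 0 1 (Complex a b) = of_real (\<sigma> * (2 * K))"
    and "mu 1 1 (Complex a b) = of_real (\<sigma> * (2 / \<alpha> * (K - E)))"
    and "mu 0 3 (Complex a b) =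
      of_real (\<sigma> ^ 3 * (2 / (1 + \<alpha>) * (2 / (1 + \<alpha>) * E - (1 - \<alpha>) * K)))"
    and "mu 0 5 (Complex a b) = of_real (\<sigma> ^ 5 * (2 / (3 * (1 + \<alpha>) ^ 4) *
      (8 * (1 + \<alpha>\<^sup>2) * E - (1 - \<alpha>) * (1 + \<alpha>) * (5 + 3 * \<alpha>\<^sup>2) * K)))"
proof -
  note \<alpha> = modulus_bounds
  have J01: "Jint \<alpha> 0 1 = 4 * K" and J11: "Jint \<alpha> 1 1 = 4 / \<alpha> * (K - E)"
    using Jint_elliptic[OF \<alpha>] by (simp_all add: K_def E_def)
  have ne: "(1 - \<alpha>\<^sup>2)\<^sup>2 = (1 - \<alpha>)\<^sup>2 * (1 + \<alpha>)\<^sup>2" "1 + \<alpha> \<noteq> 0"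
    using \<alpha> by (algebra, linarith)
  have "(1 - \<alpha>)\<^sup>2 * (1 + \<alpha>)\<^sup>2 * Jint \<alpha> 0 3 = (1 + \<alpha>\<^sup>2) * Jint \<alpha> 0 1 - 2 * \<alpha> * Jint \<alpha> 1 1"
    using Jint_exponent_lower[OF \<alpha>, of 3 0] Jint_minus[of \<alpha> 1 1] by (simp add: ne)
  also have "\<dots> = 8 * E - 4 * (1 - \<alpha>) * (1 + \<alpha>) * K"
    unfolding J01 J11 using \<alpha>(1) by (simp add: field_simps power2_eq_square)
  finally have J03: "(1 - \<alpha>)\<^sup>2 * (1 + \<alpha>)\<^sup>2 * Jint \<alpha> 0 3 = 8 * E - 4 * (1 - \<alpha>) * (1 + \<alpha>) * K" .
  have "(1 - \<alpha>)\<^sup>2 * (1 + \<alpha>)\<^sup>2 * 3 * Jint \<alpha> 0 5 = 3 * (1 + \<alpha>\<^sup>2) * Jint \<alpha> 0 3 + 2 * \<alpha> * Jint \<alpha> 1 3"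
    using Jint_exponent_lower[OF \<alpha>, of 5 0] Jint_minus[of \<alpha> 1 3] by (simp add: ne)
  \<comment> \<open>The integral at frequency 1 and exponent 3 is traded for frequency 0, so that
    only \<open>Jint \<alpha> 0 3\<close> and \<open>Jint \<alpha> 0 1\<close> occur.\<close>
  also have "2 * \<alpha> * Jint \<alpha> 1 3 = (1 + \<alpha>\<^sup>2) * Jint \<alpha> 0 3 - 4 * K"
    using Jint_frequency_up[OF \<alpha>, of 3 0] J01 by simp
  finally have "(1 - \<alpha>)\<^sup>2 * (1 + \<alpha>)\<^sup>2 * 3 * Jint \<alpha> 0 5 = 4 * (1 + \<alpha>\<^sup>2) * Jint \<alpha> 0 3 - 4 * K"
    by (simp add: algebra_simps)
  \<comment> \<open>A second factor \<open>(1 - \<alpha>)^2 * (1 + \<alpha>)^2\<close> lets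
    \<open>J03\<close> be inserted without division. The polynomial in the result arises as \<open>4
    * (1 + \<alpha>^2) + (1 - \<alpha>) * (1 + \<alpha>) = 5 + 3 * \<alpha>^2\<close>.\<close>
  then have "(1 - \<alpha>)\<^sup>2 * (1 + \<alpha>)\<^sup>2 * ((1 - \<alpha>)\<^sup>2 * (1 + \<alpha>)\<^sup>2 * 3 * Jint \<alpha> 0 5) =
      4 * (1 + \<alpha>\<^sup>2) * ((1 - \<alpha>)\<^sup>2 * (1 + \<alpha>)\<^sup>2 * Jint \<alpha> 0 3) - 4 * ((1 - \<alpha>)\<^sup>2 * (1 + \<alpha>)\<^sup>2) * K"
    by (simp only: right_diff_distrib mult_ac)
  also have "\<dots> = 4 * (8 * (1 + \<alpha>\<^sup>2) * E - (1 - \<alpha>) * (1 + \<alpha>) * (5 + 3 * \<alpha>\<^sup>2) * K)"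
    unfolding J03 by (simp add: power2_eq_square algebra_simps)
  finally have J05: "(1 - \<alpha>) ^ 4 * (3 * (1 + \<alpha>) ^ 4) * Jint \<alpha> 0 5 =
      4 * (8 * (1 + \<alpha>\<^sup>2) * E - (1 - \<alpha>) * (1 + \<alpha>) * (5 + 3 * \<alpha>\<^sup>2) * K)"
    by (simp add: power4_eq_xxxx power2_eq_square mult_ac)
  show "mu 0 1 (Complex a b) = of_real (\<sigma> * (2 * K))"
    unfolding mu_Jint J01 by simp
  have "(1 - \<alpha>) powi (1 - 1) / 2 * \<sigma> powi 1 * (4 / \<alpha> * x) = \<sigma> * (2 / \<alpha> * x)" for x
    by simp
  then show "mu 1 1 (Complex a b) = of_real (\<sigma> * (2 / \<alpha> * (K - E)))"
    unfolding mu_Jint J11 by (rule arg_cong)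
  have "(1 - \<alpha>)\<^sup>2 / 2 * Jint \<alpha> 0 3 = 2 / (1 + \<alpha>) * (2 / (1 + \<alpha>) * E - (1 - \<alpha>) * K)"
  proof -
    have "(1 - \<alpha>)\<^sup>2 * Jint \<alpha> 0 3 = (8 * E - 4 * (1 - \<alpha>) * (1 + \<alpha>) * K) / (1 + \<alpha>)\<^sup>2"
      unfolding J03[symmetric] using ne(2) by simp
    also have "\<dots> = 2 * (2 / (1 + \<alpha>) * (2 / (1 + \<alpha>) * E - (1 - \<alpha>) * K))"
    proof -
      have "(8 * E - 4 * v * u * K) / u\<^sup>2 = 2 * (2 / u * (2 / u * E - v * K))" if "u \<noteq> 0"
        for u v :: real
        using that by (simp add: field_simps power2_eq_square)
      then show ?thesis using ne(2) .
    qed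
    finally show ?thesis by linarith
  qed
  then have "\<sigma> ^ 3 * ((1 - \<alpha>)\<^sup>2 / 2 * Jint \<alpha> 0 3) =
      \<sigma> ^ 3 * (2 / (1 + \<alpha>) * (2 / (1 + \<alpha>) * E - (1 - \<alpha>) * K))"
    by (simp only:)
  moreover have "(1 - \<alpha>) powi (3 - 1) / 2 * \<sigma> powi 3 * Jint \<alpha> 0 3 =
      \<sigma> ^ 3 * ((1 - \<alpha>)\<^sup>2 / 2 * Jint \<alpha> 0 3)"
    by simp
  ultimately show "mu 0 3 (Complex a b) =
      of_real (\<sigma> ^ 3 * (2 / (1 + \<alpha>) * (2 / (1 + \<alpha>) * E - (1 - \<alpha>) * K)))"
    unfolding mu_Jint by (simp only:)
  have "(1 - \<alpha>) ^ 4 / 2 * Jint \<alpha> 0 5 = 2 / (3 * (1 + \<alpha>) ^ 4) *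
      (8 * (1 + \<alpha>\<^sup>2) * E - (1 - \<alpha>) * (1 + \<alpha>) * (5 + 3 * \<alpha>\<^sup>2) * K)" (is "_ = 2 / _ * ?T")
  proof -
    have "(1 - \<alpha>) ^ 4 * Jint \<alpha> 0 5 = 4 * ?T / (3 * (1 + \<alpha>) ^ 4)"
      unfolding J05[symmetric] using ne(2) by simp
    moreover have "x / 2 * y = 2 / d * T" if "x * y = 4 * T / d" for x y d T :: real
      using that by simp
    ultimately show ?thesis by blast
  qed
  then have "\<sigma> ^ 5 * ((1 - \<alpha>) ^ 4 / 2 * Jint \<alpha> 0 5) = \<sigma> ^ 5 * (2 / (3 * (1 + \<alpha>) ^ 4) * ?T)"
    by (simp only:)
  moreover have "(1 - \<alpha>) powi (5 - 1) / 2 * \<sigma> powi 5 * Jint \<alpha> 0 5 =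
      \<sigma> ^ 5 * ((1 - \<alpha>) ^ 4 / 2 * Jint \<alpha> 0 5)"
    by simp
  ultimately show "mu 0 5 (Complex a b) = of_real (\<sigma> ^ 5 * (2 / (3 * (1 + \<alpha>) ^ 4) *
      (8 * (1 + \<alpha>\<^sup>2) * E - (1 - \<alpha>) * (1 + \<alpha>) * (5 + 3 * \<alpha>\<^sup>2) * K)))"
    unfolding mu_Jint by (simp only:)
qed

lemma B0_int_formula:
  "of_real (B0_int m (Complex a b)) = of_real (2 / (1 - \<alpha>) powi (m - 1)) * mu 0 m (Complex a b)"
proof -
  have "1 - \<alpha> \<noteq> 0" using modulus_bounds by simp
  then have "2 / (1 - \<alpha>) powi (m - 1) * ((1 - \<alpha>) powi (m - 1) / 2 * x) = x" for x
    by simp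
  then show ?thesis
    unfolding B0_int_eq_S_int[OF b] S_int_conv_Jint[OF b, folded \<alpha>_def \<sigma>_def] mu_Jint
      of_real_mult[symmetric] by (simp add: mult.assoc)
qed

end

text \<open>Passing from \<open>b > 0\<close> to \<open>- b\<close> multiplies \<open>mu\<close> at
  exponent \<open>m\<close> by \<open>\<alpha> ^ m\<close>. Identities with a single exponent on
  both sides are insensitive to this and are stated once; those mixing \<open>m\<close> and
  \<open>m - 2\<close>, and the initial values, acquire powers of \<open>\<alpha>\<close>, whence
  the two branches.\<close>

theorem lemma3p7:
  fixes a b \<alpha> C2 C3 C4 :: real and C1 t0 :: complex and k m :: int
  assumes "k \<ge> 0" and "m \<ge> 1" and "odd m"
    and "t0 = Complex a b" and "\<bar>b\<bar> > 0" and "\<alpha> = exp (- \<bar>b\<bar>)"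
    and "C1 = of_real ((1 - \<alpha>) powi (3 - m) / 2) * exp (\<i> * of_int k * of_real a)"
    and "C2 = (1 - \<alpha>)\<^sup>2 / (2 * \<alpha> * (1 + \<alpha>\<^sup>2))"
    and "C3 = (of_int m / 2 + of_int k - 1) / (2 * \<alpha>)"
    and "C4 = (of_int m / 2 + of_int k - 2) / (1 + \<alpha>\<^sup>2)"
  shows "of_real (B0_int m t0) = of_real (2 / (1 - \<alpha>) powi (m - 1)) * mu 0 m t0 \<and>
     B1_int m t0 = 0 \<and>
     St_int (- k) m t0 = cnj (St_int k m t0) \<and>
     (\<forall>a'. mu k m (Complex a' b) = mu k m t0) \<and>
     (m = 1 \<and> k \<ge> 2 \<longrightarrow>
       mu k m t0 =
         of_real ((1 + \<alpha>\<^sup>2) / \<alpha> * (2 * (of_int k - 1) / (2 * of_int k - 1))) * mu (k - 1) m t0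
         - of_real ((2 * of_int k - 3) / (2 * of_int k - 1)) * mu (k - 2) m t0) \<and>
     (b > 0 \<longrightarrow>
         St_int k m t0 = C1 * (- of_real C2 * mu k m t0
             + of_real (2 / (of_int m - 2)) *
                 (of_real C3 * mu k (m - 2) t0 - of_real C4 * mu (k - 1) (m - 2) t0)) \<and>
         ((m = 3 \<or> m = 5) \<and> k \<ge> 1 \<longrightarrow>
           mu k m t0 = of_real ((1 + \<alpha>\<^sup>2) / (2 * \<alpha>)) * mu (k - 1) m t0
             - of_real ((1 - \<alpha>)\<^sup>2 / (2 * \<alpha>) * ((of_int m / 2 + of_int k - 2) / (of_int m / 2 - 1)))
                 * mu (k - 1) (m - 2) t0) \<and>
         mu 0 1 t0 = of_real ((2 * ellK (\<alpha>\<^sup>2))) \<and>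
         mu 1 1 t0 = of_real ((2 / \<alpha> * (ellK (\<alpha>\<^sup>2) - ellE (\<alpha>\<^sup>2)))) \<and>
         mu 0 3 t0 = of_real ((2 / (1 + \<alpha>) *
           (2 / (1 + \<alpha>) * ellE (\<alpha>\<^sup>2) - (1 - \<alpha>) * ellK (\<alpha>\<^sup>2)))) \<and>
         mu 0 5 t0 = of_real ((2 / (3 * (1 + \<alpha>) ^ 4) *
           (8 * (1 + \<alpha>\<^sup>2) * ellE (\<alpha>\<^sup>2)
             - (1 - \<alpha>) * (1 + \<alpha>) * (5 + 3 * \<alpha>\<^sup>2) * ellK (\<alpha>\<^sup>2))))) \<and>
     (b < 0 \<longrightarrow>
         St_int k m t0 = C1 * (- of_real C2 * mu k m t0
             + of_real (2 / (of_int m - 2) * \<alpha>\<^sup>2) *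
                 (of_real C3 * mu k (m - 2) t0 - of_real C4 * mu (k - 1) (m - 2) t0)) \<and>
         ((m = 3 \<or> m = 5) \<and> k \<ge> 1 \<longrightarrow>
           mu k m t0 = of_real ((1 + \<alpha>\<^sup>2) / (2 * \<alpha>)) * mu (k - 1) m t0
             - of_real (\<alpha>\<^sup>2 * (1 - \<alpha>)\<^sup>2 / (2 * \<alpha>) * ((of_int m / 2 + of_int k - 2) / (of_int m / 2 - 1)))
                 * mu (k - 1) (m - 2) t0) \<and>
         mu 0 1 t0 = of_real (\<alpha> * (2 * ellK (\<alpha>\<^sup>2))) \<and>
         mu 1 1 t0 = of_real (\<alpha> * (2 / \<alpha> * (ellK (\<alpha>\<^sup>2) - ellE (\<alpha>\<^sup>2)))) \<and>
         mu 0 3 t0 = of_real (\<alpha> ^ 3 * (2 / (1 + \<alpha>) *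
           (2 / (1 + \<alpha>) * ellE (\<alpha>\<^sup>2) - (1 - \<alpha>) * ellK (\<alpha>\<^sup>2)))) \<and>
         mu 0 5 t0 = of_real (\<alpha> ^ 5 * (2 / (3 * (1 + \<alpha>) ^ 4) *
           (8 * (1 + \<alpha>\<^sup>2) * ellE (\<alpha>\<^sup>2)
             - (1 - \<alpha>) * (1 + \<alpha>) * (5 + 3 * \<alpha>\<^sup>2) * ellK (\<alpha>\<^sup>2)))))"
proof -
  define \<sigma> where "\<sigma> = (if b > 0 then 1 else \<alpha>)"
  have b: "b \<noteq> 0" using assms(5) by simp
  have m: "m \<noteq> 2" using \<open>odd m\<close> by auto
  have t0: "t0 = Complex a b" and \<alpha>: "\<alpha> = exp (- \<bar>b\<bar>)" by fact+
  note norm = \<alpha>[symmetric] \<sigma>_def[symmetric] t0[symmetric]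
  have B0: "of_real (B0_int m t0) = of_real (2 / (1 - \<alpha>) powi (m - 1)) * mu 0 m t0"
    using B0_int_formula[OF b, of m a] unfolding norm .
  have B1: "B1_int m t0 = 0"
    unfolding t0 by (rule B1_int_eq_0[OF b])
  have indep: "mu k m (Complex a' b) = mu k m t0" for a'
    unfolding t0 mu_conv_Jint[OF b] ..
  have rec1: "mu k m t0 =
      of_real ((1 + \<alpha>\<^sup>2) / \<alpha> * (2 * (of_int k - 1) / (2 * of_int k - 1))) * mu (k - 1) m t0 -
      of_real ((2 * of_int k - 3) / (2 * of_int k - 1)) * mu (k - 2) m t0"
    if "m = 1 \<and> k \<ge> 2"
    using mu_recurrence_1[OF b that[THEN conjunct2], of a]
    unfolding norm that[THEN conjunct1] .
  have St: "St_int k m t0 = C1 * (- of_real C2 * mu k m t0 + of_real (2 / (of_int m - 2) * \<sigma>\<^sup>2) *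
      (of_real C3 * mu k (m - 2) t0 - of_real C4 * mu (k - 1) (m - 2) t0))"
    using St_int_formula[OF b m, of k a] unfolding norm assms(7-10) .
  have rec: "mu k m t0 = of_real ((1 + \<alpha>\<^sup>2) / (2 * \<alpha>)) * mu (k - 1) m t0 -
      of_real (\<sigma>\<^sup>2 * (1 - \<alpha>)\<^sup>2 / (2 * \<alpha>) * ((of_int m / 2 + of_int k - 2) / (of_int m / 2 - 1))) *
        mu (k - 1) (m - 2) t0"
    using mu_recurrence_exponent[OF b m, of k a] unfolding norm .
  note init = mu_initial_values[OF b, where a = a, unfolded norm]
  show ?thesis
  proof (cases "b > 0")
    case True
    then have \<sigma>: "\<sigma> = 1" by (simp add: \<sigma>_def)
    note eqs = St[unfolded \<sigma> power_one mult_1_right] rec[unfolded \<sigma> power_one mult_1_left]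
      init[unfolded \<sigma> power_one mult_1_left]
    show ?thesis
      \<comment> \<open>After the introductions there remain the recurrence for
        \<open>m = 1\<close>, which still needs its premise, and the branch of the opposite sign,
        which is contradictory.\<close>
      by (intro conjI impI allI St_int_minus B0 B1 indep eqs) (erule rec1 less_asym'[OF True])+
  next
    case False
    then have \<sigma>: "\<sigma> = \<alpha>" by (simp add: \<sigma>_def)
    note eqs = St[unfolded \<sigma>] rec[unfolded \<sigma>] init[unfolded \<sigma>]
    show ?thesis
      by (intro conjI impI allI St_int_minus B0 B1 indep eqs) (erule rec1 notE[OF False])+
  qed
qed

end
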